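(* Let $(X,d)$ be an infinite metric space and let $\mathfrak{B}$ be a bornology on $X$ with closed base, $X\notin\mathfrak{B}$. The following equalities hold (where an equality of two selection principles means that $X$ satisfies one if and only if it satisfies the other): (1) $U_{fin}(\mathcal{O}_{\mathfrak{B}^s},\mathcal{O}_{\mathfrak{B}^s})=U_{fin}(\Gamma_{\mathfrak{B}^s},\mathcal{O}_{\mathfrak{B}^s})$; (2) $U_{fin}(\mathcal{O}_{\mathfrak{B}^s},\Gamma_{\mathfrak{B}^s})=U_{fin}(\Gamma_{\mathfrak{B}^s},\Gamma_{\mathfrak{B}^s})$; (3) $U_{fin}(\mathcal{O}_{\mathfrak{B}^s},\mathcal{O})=U_{fin}(\Gamma_{\mathfrak{B}^s},\mathcal{O})$; (4) $U_{fin}(\mathcal{O},\mathcal{O}_{\mathfrak{B}^s})=U_{fin}(\Gamma,\mathcal{O}_{\mathfrak{B}^s})$; (5) $U_{fin}(\mathcal{O}_{\mathfrak{B}^s},\Gamma)=U_{fin}(\Gamma_{\mathfrak{B}^s},\Gamma)$; (6) $U_{fin}(\mathcal{O},\Gamma_{\mathfrak{B}^s})=U_{fin}(\Gamma,\Gamma_{\mathfrak{B}^s})$.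
   Context: A bornology $\mathfrak{B}$ on $X$ is a family of subsets of $X$ that is closed under finite unions, hereditary (closed under taking subsets), and covers $X$. A base of $\mathfrak{B}$ is a subfamily of $\mathfrak{B}$ cofinal with respect to inclusion; it is closed if all its members are closed in $X$. For $B\in\mathfrak{B}$ and $\delta>0$, $B^\delta=\bigcup_{x\in B}\{y\in X: d(x,y)<\delta\}$. All open covers of $X$ are assumed to be countably infinite. $\mathcal{O}$ is the collection of all open covers of $X$. An open $\mathfrak{B}^s$-cover of $X$ is an open cover $\mathcal{U}$ with $X\notin\mathcal{U}$ such that for each $B\in\mathfrak{B}$ there are $U\in\mathcal{U}$ and $\delta>0$ with $B^\delta\subseteq U$; $\mathcal{O}_{\mathfrak{B}^s}$ is the collection of all of these. A $\gamma$-cover of $X$ is an infinite open cover $\mathcal{U}$ such that each $x\in X$ belongs to all but finitely many members of $\mathcal{U}$; $\Gamma$ is the collection of all $\gamma$-covers. A $\gamma_{\mathfrak{B}^s}$-cover of $X$ is an open cover $\mathcal{U}=\{U_n:n\in\mathbb{N}\}$ which is infinite and such that for each $B\in\mathfrak{B}$ there are $n_0\in\mathbb{N}$ and a sequence $\{\delta_n:n\ge n_0\}$ of positive reals with $B^{\delta_n}\subseteq U_n$ for all $n\ge n_0$; $\Gamma_{\mathfrak{B}^s}$ is the collection of all of these. $U_{fin}(\mathcal{A},\mathcal{C})$: for each sequence $\{A_n:n\in\mathbb{N}\}$ of elements of $\mathcal{A}$ there is a sequence $\{B_n:n\in\mathbb{N}\}$ of finite (possibly empty) sets with $B_n\subseteq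 A_n$ for each $n$ and either $\{\bigcup B_n:n\in\mathbb{N}\}\in\mathcal{C}$ or $\bigcup B_n=X$ for some $n$. *)

theory Defs
  imports "HOL-Analysis.Elementary_Metric_Spaces"
begin

text \<open>The metric space \<open>(X, d)\<close> is the carrier of a type of class \<^class>\<open>metric_space\<close>:
  \<open>X\<close> is \<^term>\<open>UNIV\<close> and \<open>d\<close> is \<^const>\<open>dist\<close>.\<close>

definition bornology :: "'a set set \<Rightarrow> bool" where
  "bornology \<BB> \<longleftrightarrow>
     (\<forall>\<F>. finite \<F> \<and> \<F> \<subseteq> \<BB> \<longrightarrow> \<Union>\<F> \<in> \<BB>) \<and>
     (\<forall>B\<in>\<BB>. \<forall>A. A \<subseteq> B \<longrightarrow> A \<in> \<BB>) \<and>
     \<Union>\<BB> = UNIV"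

definition bornology_base :: "'a set set \<Rightarrow> 'a set set \<Rightarrow> bool" where
  "bornology_base \<BB> \<BB>\<^sub>0 \<longleftrightarrow> \<BB>\<^sub>0 \<subseteq> \<BB> \<and> (\<forall>B\<in>\<BB>. \<exists>C\<in>\<BB>\<^sub>0. B \<subseteq> C)"

definition has_closed_base :: "'a::metric_space set set \<Rightarrow> bool" where
  "has_closed_base \<BB> \<longleftrightarrow> (\<exists>\<BB>\<^sub>0. bornology_base \<BB> \<BB>\<^sub>0 \<and> (\<forall>C\<in>\<BB>\<^sub>0. closed C))"

definition enlargement :: "'a::metric_space set \<Rightarrow> real \<Rightarrow> 'a set" where
  "enlargement B \<delta> = (\<Union>x\<in>B. ball x \<delta>)"

text \<open>Open covers are countably infinite by convention. The convention applies to all the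
  classes of covers below, also where they occur as the target of a selection principle.\<close>

definition open_covers :: "'a::metric_space set set set" where
  "open_covers = {\<U>. (\<forall>U\<in>\<U>. open U) \<and> \<Union>\<U> = UNIV \<and> countable \<U> \<and> infinite \<U>}"

definition bs_covers :: "'a::metric_space set set \<Rightarrow> 'a set set set" where
  "bs_covers \<BB> = {\<U> \<in> open_covers. UNIV \<notin> \<U> \<and>
     (\<forall>B\<in>\<BB>. \<exists>U\<in>\<U>. \<exists>\<delta>>0. enlargement B \<delta> \<subseteq> U)}"

definition gamma_covers :: "'a::metric_space set set set" where
  "gamma_covers = {\<U> \<in> open_covers. infinite \<U> \<and> (\<forall>x. finite {U \<in> \<U>. x \<notin> U})}"

text \<open>The enumeration is not required to be injective. Since the cover is infinite, requiring
  injectivity would define the same class. The whole space may be a member of the cover.\<close>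

definition gamma_bs_covers :: "'a::metric_space set set \<Rightarrow> 'a set set set" where
  "gamma_bs_covers \<BB> = {\<U> \<in> open_covers. infinite \<U> \<and>
     (\<exists>U :: nat \<Rightarrow> 'a set. \<U> = range U \<and>
       (\<forall>B\<in>\<BB>. \<exists>n\<^sub>0. \<exists>\<delta> :: nat \<Rightarrow> real. \<forall>n\<ge>n\<^sub>0. \<delta> n > 0 \<and> enlargement B (\<delta> n) \<subseteq> U n))}"

definition U_fin :: "'a set set set \<Rightarrow> 'a set set set \<Rightarrow> bool" where
  "U_fin \<A> \<C> \<longleftrightarrow>
     (\<forall>A :: nat \<Rightarrow> 'a set set. (\<forall>n. A n \<in> \<A>) \<longrightarrow>
       (\<exists>B :: nat \<Rightarrow> 'a set set. (\<forall>n. finite (B n) \<and> B n \<subseteq> A n) \<and>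
         (range (\<lambda>n. \<Union>(B n)) \<in> \<C> \<or> (\<exists>n. \<Union>(B n) = UNIV))))"

end

theory Submission imports Defs begin

text \<open>
  A selection principle \<open>U_fin \<A> \<C>\<close> looks at a cover \<open>A \<in> \<A>\<close> only through the unions of its
  finite subfamilies. Two observations follow. A cover with a finite subcover never obstructs the
  principle, since the second alternative \<open>\<Union>(B n) = UNIV\<close> can be reached at once. A cover without a
  finite subcover may be traded for any cover that consists of finite unions of its members, because
  finite selections from the latter unfold to finite selections from the former. Hence
  \<open>\<A>\<close> can be replaced by \<open>\<A>'\<close> as soon as every member of \<open>\<A>\<close> has a finite subcover or can be
  traded for a member of \<open>\<A>'\<close>, whatever the target \<open>\<C>\<close> is (lemma \<open>U_fin_trade\<close>).

  For a countable cover \<open>{U\<^sub>0, U\<^sub>1, \<dots>}\<close> without a finite subcover the trade goes to the partial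
  unions \<open>V\<^sub>m = U\<^sub>0 \<union> \<dots> \<union> U\<^sub>m\<close>. They increase to the whole space without ever reaching it, so they
  form an infinite family, and whatever is captured by one \<open>U\<^sub>k\<close> is captured by all \<open>V\<^sub>m\<close> with
  \<open>m \<ge> k\<close>. Applied to points this yields a \<open>\<gamma>\<close>-cover, and applied to enlargements of the sets in
  \<open>\<BB>\<close> it yields a \<open>\<gamma>\<close>-cover relative to \<open>\<BB>\<close>. Conversely, a \<open>\<gamma>\<close>-type cover already
  belongs to the larger class, except that a \<open>\<gamma>\<close>-cover relative to \<open>\<BB>\<close> may contain \<open>UNIV\<close>; but then
  it has a one-element subcover.
\<close>

text \<open>If one of the given covers has a finite subcover, it is selected at that index
  and the empty family everywhere else. Otherwise all covers are traded simultaneously, and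
  a finite selection from the traded cover unfolds to a finite selection with the same union.\<close>

lemma U_fin_trade:
  fixes \<A> \<A>' \<C> :: "'a set set set"
  assumes trade: "\<And>A. A \<in> \<A> \<Longrightarrow> \<forall>F\<subseteq>A. finite F \<longrightarrow> \<Union>F \<noteq> UNIV \<Longrightarrow>
      \<exists>A'\<in>\<A>'. \<forall>V\<in>A'. \<exists>F\<subseteq>A. finite F \<and> \<Union>F = V"
    and U_fin: "U_fin \<A>' \<C>"
  shows "U_fin \<A> \<C>"
  unfolding U_fin_def
proof (intro allI impI)
  fix A :: "nat \<Rightarrow> 'a set set"
  assume A: "\<forall>n. A n \<in> \<A>"
  show "\<exists>B. (\<forall>n. finite (B n) \<and> B n \<subseteq> A n) \<and>
      (range (\<lambda>n. \<Union>(B n)) \<in> \<C> \<or> (\<exists>n. \<Union>(B n) = UNIV))"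
  proof (cases "\<exists>n F. F \<subseteq> A n \<and> finite F \<and> \<Union>F = UNIV")
    case True
    then obtain n F where F: "F \<subseteq> A n" "finite F" "\<Union>F = UNIV"
      by blast
    then show ?thesis
      by (intro exI[of _ "\<lambda>k. if k = n then F else {}"]) auto
  next
    case False
    have "\<exists>A'. A' \<in> \<A>' \<and> (\<forall>V\<in>A'. \<exists>F\<subseteq>A n. finite F \<and> \<Union>F = V)" for n
    proof -
      have "\<forall>F\<subseteq>A n. finite F \<longrightarrow> \<Union>F \<noteq> UNIV"
        using False by auto
      with A show ?thesis
        using trade[of "A n"] by auto
    qed
    then obtain A' where A': "\<And>n. A' n \<in> \<A>'"
      and refine: "\<And>n. \<forall>V\<in>A' n. \<exists>F\<subseteq>A n. finite F \<and> \<Union>F = V"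
      by metis
    from refine have "\<forall>n. \<forall>V\<in>A' n. \<exists>F. F \<subseteq> A n \<and> finite F \<and> \<Union>F = V"
      by auto
    then obtain F where F: "\<And>n V. V \<in> A' n \<Longrightarrow> F n V \<subseteq> A n \<and> finite (F n V) \<and> \<Union>(F n V) = V"
      by metis
    from U_fin A' have "\<exists>C. (\<forall>n. finite (C n) \<and> C n \<subseteq> A' n) \<and>
        (range (\<lambda>n. \<Union>(C n)) \<in> \<C> \<or> (\<exists>n. \<Union>(C n) = UNIV))"
      unfolding U_fin_def by simp
    then obtain C where C: "\<And>n. finite (C n) \<and> C n \<subseteq> A' n"
      and sel: "range (\<lambda>n. \<Union>(C n)) \<in> \<C> \<or> (\<exists>n. \<Union>(C n) = UNIV)"
      by (elim exE conjE) blast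
    define B where "B n = (\<Union>V\<in>C n. F n V)" for n
    have "finite (B n) \<and> B n \<subseteq> A n" for n
      using C[of n] F[of _ n] unfolding B_def by blast
    moreover have "\<Union>(B n) = \<Union>(C n)" for n
    proof -
      have "\<Union>(B n) = (\<Union>V\<in>C n. \<Union>(F n V))"
        unfolding B_def by blast
      also have "\<dots> = (\<Union>V\<in>C n. V)"
        using C[of n] F[of _ n] by (intro SUP_cong) auto
      finally show ?thesis
        by simp
    qed
    ultimately show ?thesis
      using sel by (intro exI[of _ B]) simp
  qed
qed

text \<open>A finite increasing family would contain its union, so partial unions that stay proper
  must be infinitely many. The last clause is the reason for passing to partial unions: it turns
  ``some member of the cover'' into ``all but finitely many members''.\<close>

lemma partial_unions_of_open_cover:
  fixes A :: "'a::metric_space set set"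
  assumes "A \<in> open_covers" and no_fin: "\<forall>F\<subseteq>A. finite F \<longrightarrow> \<Union>F \<noteq> UNIV"
  obtains V :: "nat \<Rightarrow> 'a set" where
    "range V \<in> open_covers"
    "\<forall>S\<in>range V. \<exists>F\<subseteq>A. finite F \<and> \<Union>F = S"
    "\<forall>U\<in>A. \<exists>k. \<forall>m\<ge>k. U \<subseteq> V m"
proof -
  have A: "\<And>U. U \<in> A \<Longrightarrow> open U" "\<Union>A = UNIV" "countable A" "A \<noteq> {}"
    using assms(1) unfolding open_covers_def by auto
  define U where "U = from_nat_into A"
  have range_U: "range U = A"
    using A range_from_nat_into U_def by metis
  define V where "V m = \<Union>(U ` {..m})" for m
  have fin: "\<exists>F\<subseteq>A. finite F \<and> \<Union>F = V m" for m
    unfolding V_def using range_U by (intro exI[of _ "U ` {..m}"]) auto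
  then have proper: "V m \<noteq> UNIV" for m
    using no_fin by metis
  have "mono V"
    unfolding V_def by (intro monoI Union_mono image_mono) auto
  have tail: "\<exists>k. \<forall>m\<ge>k. W \<subseteq> V m" if "W \<in> A" for W
    using that range_U unfolding V_def by blast
  then have cover: "\<Union>(range V) = UNIV"
  proof (intro equalityI subsetI)
    fix x
    from A(2) obtain W where "W \<in> A" "x \<in> W"
      by blast
    then show "x \<in> \<Union>(range V)"
      using tail[OF \<open>W \<in> A\<close>] by blast
  qed simp
  have "infinite (range V)"
  proof
    assume "finite (range V)"
    then obtain M where M: "finite M" "range V = V ` M"
      using finite_subset_image[of "range V" V UNIV] by blast
    have "V n \<subseteq> V (Max M)" for n
    proof -
      obtain m where "m \<in> M" "V n = V m"
        using M(2) by blast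
      then show ?thesis
        using monoD[OF \<open>mono V\<close>, of m "Max M"] M(1) by simp
    qed
    then have "\<Union>(range V) \<subseteq> V (Max M)"
      by (intro UN_least)
    then show False
      using cover proper[of "Max M"] by auto
  qed
  moreover have "open (V m)" for m
    unfolding V_def using A(1) range_U by (intro open_Union) auto
  ultimately have "range V \<in> open_covers"
    using cover unfolding open_covers_def by auto
  then show thesis
    using that[of V] fin tail by auto
qed

lemma open_cover_trade_gamma_cover:
  fixes A :: "'a::metric_space set set"
  assumes "A \<in> open_covers" "\<forall>F\<subseteq>A. finite F \<longrightarrow> \<Union>F \<noteq> UNIV"
  shows "\<exists>A'\<in>gamma_covers. \<forall>V\<in>A'. \<exists>F\<subseteq>A. finite F \<and> \<Union>F = V"
proof -
  from partial_unions_of_open_cover[OF assms]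
  obtain V :: "nat \<Rightarrow> 'a set"
    where V: "range V \<in> open_covers" "\<forall>S\<in>range V. \<exists>F\<subseteq>A. finite F \<and> \<Union>F = S"
    and tail: "\<forall>U\<in>A. \<exists>k. \<forall>m\<ge>k. U \<subseteq> V m"
    by blast
  have "finite {S \<in> range V. x \<notin> S}" for x
  proof -
    obtain U where "U \<in> A" "x \<in> U"
      using assms(1) unfolding open_covers_def by blast
    then obtain k where k: "\<forall>m\<ge>k. x \<in> V m"
      using tail by (meson subsetD)
    then have "{S \<in> range V. x \<notin> S} \<subseteq> V ` {..<k}"
      using not_le by blast
    then show ?thesis
      using finite_surj by blast
  qed
  then have "range V \<in> gamma_covers"
    using V(1) unfolding gamma_covers_def open_covers_def by auto
  then show ?thesis
    using V(2) by blast
qed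

lemma bs_cover_trade_gamma_bs_cover:
  fixes A :: "'a::metric_space set set"
  assumes "A \<in> bs_covers \<BB>" "\<forall>F\<subseteq>A. finite F \<longrightarrow> \<Union>F \<noteq> UNIV"
  shows "\<exists>A'\<in>gamma_bs_covers \<BB>. \<forall>V\<in>A'. \<exists>F\<subseteq>A. finite F \<and> \<Union>F = V"
proof -
  have "A \<in> open_covers"
    using assms(1) unfolding bs_covers_def by blast
  from partial_unions_of_open_cover[OF this assms(2)]
  obtain V :: "nat \<Rightarrow> 'a set"
    where V: "range V \<in> open_covers" "\<forall>S\<in>range V. \<exists>F\<subseteq>A. finite F \<and> \<Union>F = S"
    and tail: "\<forall>U\<in>A. \<exists>k. \<forall>m\<ge>k. U \<subseteq> V m"
    by blast
  have "\<exists>n\<^sub>0. \<exists>\<delta> :: nat \<Rightarrow> real. \<forall>n\<ge>n\<^sub>0. \<delta> n > 0 \<and> enlargement B (\<delta> n) \<subseteq> V n" if "B \<in> \<BB>" for B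
  proof -
    have "\<exists>U\<in>A. \<exists>\<delta>>0. enlargement B \<delta> \<subseteq> U"
      using assms(1) that by (simp add: bs_covers_def)
    then obtain U \<delta> where U: "U \<in> A" "\<delta> > 0" "enlargement B \<delta> \<subseteq> U"
      by auto
    with tail obtain k where "\<forall>m\<ge>k. U \<subseteq> V m"
      by auto
    \<comment> \<open>The radius found for the single set \<open>U\<close> serves the whole tail, which contains \<open>U\<close>.\<close>
    with U have "\<forall>n\<ge>k. \<delta> > 0 \<and> enlargement B \<delta> \<subseteq> V n"
      by auto
    then show ?thesis
      by (intro exI[of _ k] exI[of _ "\<lambda>_. \<delta>"])
  qed
  then have "range V \<in> gamma_bs_covers \<BB>"
    using V(1) unfolding gamma_bs_covers_def open_covers_def by auto
  then show ?thesis
    using V(2) by blast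
qed

lemma gamma_bs_cover_is_bs_cover:
  fixes A :: "'a::metric_space set set"
  assumes "A \<in> gamma_bs_covers \<BB>" "UNIV \<notin> A"
  shows "A \<in> bs_covers \<BB>"
proof -
  have "\<exists>U\<in>A. \<exists>\<delta>>0. enlargement B \<delta> \<subseteq> U" if "B \<in> \<BB>" for B
  proof -
    have "\<exists>U :: nat \<Rightarrow> 'a set. A = range U \<and>
        (\<forall>B\<in>\<BB>. \<exists>n\<^sub>0. \<exists>\<delta> :: nat \<Rightarrow> real. \<forall>n\<ge>n\<^sub>0. \<delta> n > 0 \<and> enlargement B (\<delta> n) \<subseteq> U n)"
      using assms(1) by (simp add: gamma_bs_covers_def)
    then obtain U :: "nat \<Rightarrow> 'a set" where "A = range U"
      and U: "\<forall>B\<in>\<BB>. \<exists>n\<^sub>0. \<exists>\<delta> :: nat \<Rightarrow> real. \<forall>n\<ge>n\<^sub>0. \<delta> n > 0 \<and> enlargement B (\<delta> n) \<subseteq> U n"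
      by (elim exE conjE)
    moreover from bspec[OF U that]
    obtain n\<^sub>0 and \<delta> :: "nat \<Rightarrow> real" where "\<forall>n\<ge>n\<^sub>0. \<delta> n > 0 \<and> enlargement B (\<delta> n) \<subseteq> U n"
      by (elim exE)
    ultimately show ?thesis
      by (intro bexI[of _ "U n\<^sub>0"] exI[of _ "\<delta> n\<^sub>0"]) auto
  qed
  then show ?thesis
    using assms by (simp add: gamma_bs_covers_def bs_covers_def)
qed

lemma U_fin_open_covers_iff_gamma_covers:
  "U_fin open_covers \<C> \<longleftrightarrow> U_fin gamma_covers \<C>"
proof
  assume "U_fin open_covers \<C>"
  then show "U_fin gamma_covers \<C>"
    unfolding U_fin_def by (simp add: gamma_covers_def)
next
  assume "U_fin gamma_covers \<C>"
  then show "U_fin open_covers \<C>"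
    by (rule U_fin_trade[rotated]) (rule open_cover_trade_gamma_cover)
qed

lemma U_fin_bs_covers_iff_gamma_bs_covers:
  "U_fin (bs_covers \<BB>) \<C> \<longleftrightarrow> U_fin (gamma_bs_covers \<BB>) \<C>"
proof
  assume "U_fin (bs_covers \<BB>) \<C>"
  then show "U_fin (gamma_bs_covers \<BB>) \<C>"
  proof (rule U_fin_trade[rotated])
    fix A
    assume A: "A \<in> gamma_bs_covers \<BB>" and no_fin: "\<forall>F\<subseteq>A. finite F \<longrightarrow> \<Union>F \<noteq> UNIV"
    from no_fin have "UNIV \<notin> A"
      by (auto dest: spec[of _ "{UNIV}"])
    with A have "A \<in> bs_covers \<BB>"
      by (rule gamma_bs_cover_is_bs_cover)
    moreover have "\<forall>V\<in>A. \<exists>F\<subseteq>A. finite F \<and> \<Union>F = V"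
    proof
      fix V
      assume "V \<in> A"
      then show "\<exists>F\<subseteq>A. finite F \<and> \<Union>F = V"
        by (intro exI[of _ "{V}"]) simp
    qed
    ultimately show "\<exists>A'\<in>bs_covers \<BB>. \<forall>V\<in>A'. \<exists>F\<subseteq>A. finite F \<and> \<Union>F = V"
      by blast
  qed
next
  assume "U_fin (gamma_bs_covers \<BB>) \<C>"
  then show "U_fin (bs_covers \<BB>) \<C>"
    by (rule U_fin_trade[rotated]) (rule bs_cover_trade_gamma_bs_cover)
qed

theorem theorem3p4:
  fixes \<BB> :: "'a::metric_space set set"
  assumes "infinite (UNIV :: 'a set)"
    and "bornology \<BB>"
    and "has_closed_base \<BB>"
    and "UNIV \<notin> \<BB>"
  shows "(U_fin (bs_covers \<BB>) (bs_covers \<BB>) \<longleftrightarrow> U_fin (gamma_bs_covers \<BB>) (bs_covers \<BB>)) \<and>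
    (U_fin (bs_covers \<BB>) (gamma_bs_covers \<BB>) \<longleftrightarrow> U_fin (gamma_bs_covers \<BB>) (gamma_bs_covers \<BB>)) \<and>
    (U_fin (bs_covers \<BB>) open_covers \<longleftrightarrow> U_fin (gamma_bs_covers \<BB>) open_covers) \<and>
    (U_fin open_covers (bs_covers \<BB>) \<longleftrightarrow> U_fin gamma_covers (bs_covers \<BB>)) \<and>
    (U_fin (bs_covers \<BB>) gamma_covers \<longleftrightarrow> U_fin (gamma_bs_covers \<BB>) gamma_covers) \<and>
    (U_fin open_covers (gamma_bs_covers \<BB>) \<longleftrightarrow> U_fin gamma_covers (gamma_bs_covers \<BB>))"
  using U_fin_bs_covers_iff_gamma_bs_covers U_fin_open_covers_iff_gamma_covers by blast

end
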